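(* Let $f(s)=\sum_{k\ge0}p_ks^k$ be a probability generating function with $f(1)=1$, $f'(1)=1$ and $f'''(1)<\infty$. Put $m_2=f''(1)/2$, $m_3=f'''(1)/6$, for $x\in[0,1)$ $$f_3(x)=\frac{f(x)-x}{(1-x)^2},\qquad f_4(x)=\frac{m_2-f_3(x)}{1-x},\qquad f_5(x)=\frac{m_3-f_4(x)}{1-x},$$ and $$\psi_{1,1}(x)=\frac{f_4^2(x)}{m_2^2f_3(x)}-\frac{f_5(x)}{m_2^2}.$$ Then $\int_0^1|\psi_{1,1}(x)|\,dx<\infty$ if and only if $$\sum_{k=2}^\infty p_kk^3\ln k<\infty.$$ If the latter condition does not hold, then the function $\mathcal L_{1,1}(x)=\exp\big\{\int_0^{1-x}\psi_{1,1}(s)\,ds\big\}$ is slowly varying as $x\to0$ and $\mathcal L_{1,1}(x)\to0$ as $x\to0$.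
   Context: The trivial case $p_1=1$ is excluded throughout. A positive function $\mathcal L$ is slowly varying as $x\to0$ if $\mathcal L(cx)/\mathcal L(x)\to1$ as $x\downarrow0$ for every $c>0$. *)

theory Defs
  imports "HOL-Analysis.Analysis"
begin

definition pgf :: "(nat \<Rightarrow> real) \<Rightarrow> real \<Rightarrow> real" where
  "pgf p s = (\<Sum>k. p k * s ^ k)"

text \<open>
  The \<open>r\<close>-th derivative of a generating function at its boundary point \<open>1\<close>, read as usual as
  the left limit of the \<open>r\<close>-th derivative on \<open>[0,1)\<close>. For a power series with nonnegative
  coefficients converging at \<open>1\<close> that derivative is monotone on \<open>[0,1)\<close>, so the limit exists in
  the extended reals; it may be \<open>\<infinity>\<close>.
\<close>
definition deriv_at_one :: "nat \<Rightarrow> (real \<Rightarrow> real) \<Rightarrow> ereal" where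
  "deriv_at_one r f = Lim (at_left 1) (\<lambda>s. ereal ((deriv ^^ r) f s))"

definition m2 :: "(real \<Rightarrow> real) \<Rightarrow> real" where
  "m2 f = real_of_ereal (deriv_at_one 2 f) / 2"

definition m3 :: "(real \<Rightarrow> real) \<Rightarrow> real" where
  "m3 f = real_of_ereal (deriv_at_one 3 f) / 6"

text \<open>The following functions are only meaningful on \<open>[0,1)\<close>.\<close>

definition f3 :: "(real \<Rightarrow> real) \<Rightarrow> real \<Rightarrow> real" where
  "f3 f x = (f x - x) / (1 - x)\<^sup>2"

definition f4 :: "(real \<Rightarrow> real) \<Rightarrow> real \<Rightarrow> real" where
  "f4 f x = (m2 f - f3 f x) / (1 - x)"

definition f5 :: "(real \<Rightarrow> real) \<Rightarrow> real \<Rightarrow> real" where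
  "f5 f x = (m3 f - f4 f x) / (1 - x)"

definition psi11 :: "(real \<Rightarrow> real) \<Rightarrow> real \<Rightarrow> real" where
  "psi11 f x = (f4 f x)\<^sup>2 / ((m2 f)\<^sup>2 * f3 f x) - f5 f x / (m2 f)\<^sup>2"

text \<open>Only the values on \<open>(0,1]\<close> are meaningful.\<close>
definition L11 :: "(real \<Rightarrow> real) \<Rightarrow> real \<Rightarrow> real" where
  "L11 f x = exp (LBINT s=ereal 0..ereal (1 - x). psi11 f s)"

definition slowly_varying_at_zero :: "(real \<Rightarrow> real) \<Rightarrow> bool" where
  "slowly_varying_at_zero L \<longleftrightarrow>
     (\<forall>x>0. L x > 0) \<and> (\<forall>c>0. ((\<lambda>x. L (c * x) / L x) \<longlongrightarrow> 1) (at_right 0))"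

end

theory Submission
  imports Defs
begin

text \<open>
  Each of the functions \<open>f3\<close>, \<open>f4\<close>, \<open>f5\<close> is linear in the law \<open>p\<close>, so it suffices to expand \<open>x ^ k\<close>
  around \<open>1\<close>. Its successive Taylor quotients are the polynomials
  \<open>tquot j k x = (\<Sum>i<k. (k - 1 - i choose j) * x ^ i)\<close>, which have nonnegative coefficients; hence
  \<open>f5 x = (\<Sum>k. p k * tquot 3 k x)\<close> is nonnegative and, by Tonelli,
  \<open>\<integral>\<^sub>0\<^sup>1 f5 = (\<Sum>k. p k * (k choose 3) * (H\<^sub>k - H\<^sub>3))\<close> with harmonic numbers \<open>H\<^sub>k\<close>. The other summand
  \<open>f4\<^sup>2 / (m2\<^sup>2 f3)\<close> of \<open>\<psi>\<^sub>1\<^sub>,\<^sub>1\<close> extends continuously to \<open>[0,1]\<close>, so the integrability of \<open>\<psi>\<^sub>1\<^sub>,\<^sub>1\<close> is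
  that of \<open>f5\<close>. Slow variation holds because \<open>(1 - x) \<psi>\<^sub>1\<^sub>,\<^sub>1 x \<rightarrow> 0\<close>: the logarithm of the quotient
  \<open>\<L>(c x) / \<L>(x)\<close> is an integral of \<open>o(1 / y)\<close> over an interval with endpoints \<open>x\<close> and \<open>c x\<close>.
\<close>

subsection \<open>Taylor quotients of monomials at \<open>1\<close>\<close>

text \<open>The index \<open>j\<close> counts divisions: \<open>tquot 0 k\<close> is the geometric
  sum (1 - x^k) / (1 - x), and each further index subtracts from the value at 1 and divides by 1 -
  x. As i < k, the natural subtraction never truncates.\<close>

definition tquot :: "nat \<Rightarrow> nat \<Rightarrow> real \<Rightarrow> real" where
  "tquot j k x = (\<Sum>i<k. real ((k - 1 - i) choose j) * x ^ i)"

lemma tquot_0 [simp]: "tquot j 0 x = 0"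
  by (simp add: tquot_def)

text \<open>Horner form: splitting off the constant term shifts the rest by one power, which opens
  the way to induction on \<open>k\<close>.\<close>

lemma tquot_Suc: "tquot j (Suc k) x = real (k choose j) + x * tquot j k x"
  unfolding tquot_def
  by (subst sum.lessThan_Suc_shift) (simp add: sum_distrib_left mult.left_commute)

lemma tquot_zeroth: "(1 - x) * tquot 0 k x = 1 - x ^ k"
proof (induction k)
  case (Suc k)
  have "(1 - x) * tquot 0 (Suc k) x = (1 - x) + x * ((1 - x) * tquot 0 k x)"
    by (simp add: tquot_Suc algebra_simps)
  also have "\<dots> = 1 - x ^ Suc k"
    unfolding Suc.IH by (simp add: algebra_simps)
  finally show ?case .
qed simp

text \<open>Pascal's rule inside the Horner recursion. Summed against the law, this is the passage
  from one of \<open>f3\<close>, \<open>f4\<close>, \<open>f5\<close> to the next.\<close>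

lemma tquot_step: "(1 - x) * tquot (Suc j) k x = real (k choose Suc j) - tquot j k x"
proof (induction k)
  case (Suc k)
  have "(1 - x) * tquot (Suc j) (Suc k) x
      = (1 - x) * real (k choose Suc j) + x * ((1 - x) * tquot (Suc j) k x)"
    by (simp add: tquot_Suc algebra_simps)
  also have "\<dots> = real (Suc k choose Suc j) - tquot j (Suc k) x"
    unfolding Suc.IH by (simp add: tquot_Suc algebra_simps)
  finally show ?case .
qed simp

lemma tquot_nonneg: "0 \<le> x \<Longrightarrow> 0 \<le> tquot j k x"
  by (simp add: tquot_def sum_nonneg)

lemma tquot_mono: "0 \<le> x \<Longrightarrow> x \<le> y \<Longrightarrow> tquot j k x \<le> tquot j k y"
  by (simp add: tquot_def sum_mono mult_left_mono power_mono)

lemma tquot_at_1: "tquot j k 1 = real (k choose Suc j)"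
  using tquot_step[of 1 j k] by simp

lemma tquot_le: "0 \<le> x \<Longrightarrow> x \<le> 1 \<Longrightarrow> tquot j k x \<le> real (k choose Suc j)"
  using tquot_mono[of x 1 j k] by (simp add: tquot_at_1)

lemma continuous_on_tquot [continuous_intros]: "continuous_on A (tquot j k)"
  unfolding tquot_def by (intro continuous_intros)

definition tquot_int :: "nat \<Rightarrow> nat \<Rightarrow> real \<Rightarrow> real" where
  "tquot_int j k x = (\<Sum>i<k. real ((k - 1 - i) choose j) * x ^ Suc i / real (Suc i))"

lemma tquot_int_at_0 [simp]: "tquot_int j k 0 = 0"
  by (simp add: tquot_int_def)

lemma tquot_int_nonneg: "0 \<le> x \<Longrightarrow> 0 \<le> tquot_int j k x"
  by (simp add: tquot_int_def sum_nonneg)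

lemma has_real_derivative_tquot_int:
  "(tquot_int j k has_real_derivative tquot j k x) (at x within A)"
  unfolding tquot_int_def tquot_def
  by (auto intro!: derivative_eq_intros sum.cong simp del: power_Suc of_nat_Suc)

lemma continuous_on_tquot_int: "continuous_on A (tquot_int j k)"
  by (meson DERIV_continuous_on has_real_derivative_tquot_int)

text \<open>Induction on \<open>k\<close> with Pascal's rule. The weights 1 / (i + 1) from
  integration accumulate to harmonic numbers, the source of the logarithm in the moment
  condition.\<close>

lemma tquot_int_at_1: "tquot_int j k 1 = real (k choose j) * (harm k - harm j)"
proof (induction k arbitrary: j)
  case 0
  then show ?case by (cases j) (auto simp: tquot_int_def harm_def)
next
  case (Suc k)
  show ?case
  proof (cases j)
    case 0
    then show ?thesis
      by (simp add: tquot_int_def harm_def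
          sum.atLeast1_atMost_eq inverse_eq_divide)
  next
    case (Suc l)
    \<comment> \<open>Pascal's rule for the terms i < k; the extra top term i = k vanishes because
      \<open>0 choose Suc l\<close> is 0.\<close>
    have "real ((Suc k - 1 - i) choose Suc l) = real ((k - 1 - i) choose l) + real ((k - 1 - i) choose Suc l)"
      if "i < k" for i
      using that by (simp add: Suc_diff_Suc flip: of_nat_add binomial_Suc_Suc)
    then have "tquot_int (Suc l) (Suc k) 1 = tquot_int l k 1 + tquot_int (Suc l) k 1"
      by (simp add: tquot_int_def add_divide_distrib flip: sum.distrib)
    also have "\<dots> = real (k choose l) * (harm k - harm l)
                   + real (k choose Suc l) * (harm k - harm (Suc l))"
      by (simp only: Suc.IH)
    \<comment> \<open>Trading \<open>harm l\<close> for \<open>harm (Suc l)\<close> leaves one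
      correction term; absorption turns it into the step from \<open>harm k\<close> to
      \<open>harm (Suc k)\<close>.\<close>
    also have "\<dots> = real (Suc k choose Suc l) * (harm k - harm (Suc l)) + real (k choose l) / real (Suc l)"
      by (simp add: harm_Suc algebra_simps inverse_eq_divide)
    also have "real (k choose l) / real (Suc l) = real (Suc k choose Suc l) / real (Suc k)"
    proof -
      have "real (Suc k) * real (k choose l) = real (Suc k choose Suc l) * real (Suc l)"
        by (metis Suc_times_binomial_eq of_nat_mult)
      then show ?thesis
        by (simp add: field_simps del: binomial_Suc_Suc)
    qed
    finally show ?thesis
      by (simp add: Suc harm_Suc algebra_simps inverse_eq_divide del: binomial_Suc_Suc)
  qed
qed

text \<open>The endpoint 1 is a null set, so the fundamental theorem on the closed interval gives
  the integral over the half-open one, where \<open>f5\<close> is meaningful.\<close>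

lemma nn_integral_tquot:
  "(\<integral>\<^sup>+x\<in>{0..<1}. ennreal (tquot j k x) \<partial>lborel) = ennreal (tquot_int j k 1)"
proof -
  have "(\<integral>\<^sup>+x\<in>{0..<1}. ennreal (tquot j k x) \<partial>lborel) = (\<integral>\<^sup>+x\<in>{0..1}. ennreal (tquot j k x) \<partial>lborel)"
  proof (rule nn_integral_cong_AE)
    show "AE x in lborel. ennreal (tquot j k x) * indicator {0..<1} x = ennreal (tquot j k x) * indicator {0..1} x"
      using AE_lborel_singleton[of "1::real"] by eventually_elim (auto simp: indicator_def)
  qed
  also have "\<dots> = ennreal (tquot_int j k 1 - tquot_int j k 0)"
    by (rule nn_integral_FTC_Icc)
       (auto intro: has_real_derivative_tquot_int tquot_nonneg borel_measurable_continuous_onI continuous_on_tquot)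
  finally show ?thesis by simp
qed

subsection \<open>Derivatives at the boundary\<close>

text \<open>Iterating \<open>diffs\<close> produces falling factorials; writing them as
  \<open>fact r\<close> times a binomial coefficient matches the values of \<open>tquot\<close> at
  1.\<close>

lemma funpow_diffs: "(diffs ^^ r) p n = fact r * real ((n + r) choose r) * p (n + r)"
  for p :: "nat \<Rightarrow> real"
proof (induction r arbitrary: n)
  case (Suc r)
  have "real (Suc n) * (fact r * real (Suc (n + r) choose r)) = fact (Suc r) * real (Suc (n + r) choose Suc r)"
  proof -
    have "(n + Suc r choose r) * Suc n = (n + Suc r choose Suc r) * Suc r"
      using binomial_absorb_comp[of "Suc (n + r)" r] binomial_absorption[of r "n + Suc r"]
      by (simp add: mult.commute del: binomial_Suc_Suc)
    then have "real (n + Suc r choose r) * real (Suc n) = real (n + Suc r choose Suc r) * real (Suc r)"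
      by (metis of_nat_mult)
    then show ?thesis
      by (simp add: mult_ac del: binomial_Suc_Suc)
  qed
  then show ?case
    by (simp add: diffs_def[of "(diffs ^^ r) p"] Suc.IH mult.assoc[symmetric] del: binomial_Suc_Suc)
qed simp

lemma summable_funpow_diffs:
  fixes p :: "nat \<Rightarrow> real"
  assumes "summable p" "\<bar>x\<bar> < 1"
  shows "summable (\<lambda>n. (diffs ^^ r) p n * x ^ n)"
  using assms(2)
proof (induction r arbitrary: x)
  case 0
  then show ?case using powser_inside[of p 1 x] assms(1) by simp
next
  case (Suc r)
  then show ?case using termdiff_converges[of x 1 "(diffs ^^ r) p"] by simp
qed

lemma funpow_deriv_pgf:
  assumes "summable p" "\<bar>x\<bar> < 1"
  shows "(deriv ^^ r) (pgf p) x = pgf ((diffs ^^ r) p) x"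
  using assms(2)
proof (induction r arbitrary: x)
  case (Suc r)
  \<comment> \<open>\<open>deriv\<close> at x depends on nearby values, so the induction hypothesis
    is needed on a neighbourhood of x.\<close>
  have "eventually (\<lambda>y. \<bar>y\<bar> < 1) (nhds x)"
    using Suc.prems by (intro eventually_nhds_in_open[of "{y. \<bar>y\<bar> < 1}", simplified])
       (auto intro!: open_Collect_less continuous_intros)
  then have "eventually (\<lambda>y. (deriv ^^ r) (pgf p) y = pgf ((diffs ^^ r) p) y) (nhds x)"
    by eventually_elim (rule Suc.IH)
  then have "deriv ((deriv ^^ r) (pgf p)) x = deriv (pgf ((diffs ^^ r) p)) x"
    by (intro deriv_cong_ev) auto
  also have "\<dots> = pgf (diffs ((diffs ^^ r) p)) x"
  proof (rule DERIV_imp_deriv)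
    show "(pgf ((diffs ^^ r) p) has_field_derivative pgf (diffs ((diffs ^^ r) p)) x) (at x)"
      unfolding pgf_def
      using Suc.prems by (intro termdiffs_strong'[of 1] summable_funpow_diffs assms(1)) auto
  qed
  finally show ?case by simp
qed simp

lemma continuous_on_suminf_nonneg:
  fixes u :: "nat \<Rightarrow> real \<Rightarrow> real"
  assumes "summable M" "\<And>k x. x \<in> A \<Longrightarrow> \<bar>u k x\<bar> \<le> M k" "\<And>k. continuous_on A (u k)"
  shows "continuous_on A (\<lambda>x. \<Sum>k. u k x)"
proof (rule uniform_limit_theorem)
  show "uniform_limit A (\<lambda>n x. \<Sum>k<n. u k x) (\<lambda>x. \<Sum>k. u k x) sequentially"
    using assms by (intro Weierstrass_m_test) auto
  show "\<forall>\<^sub>F n in sequentially. continuous_on A (\<lambda>x. \<Sum>k<n. u k x)"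
    by (intro always_eventually allI continuous_on_sum assms)
qed simp

text \<open>Convergent case: continuity up to 1 by the M-test. Divergent case: some partial sum at 1
  exceeds any given bound, by continuity it still does so near 1, and nonnegative coefficients keep
  the full series above it.\<close>

lemma pgf_left_limit:
  assumes nonneg: "\<And>n. 0 \<le> c n" and conv: "\<And>x. \<bar>x\<bar> < 1 \<Longrightarrow> summable (\<lambda>n. c n * x ^ n)"
  shows "((\<lambda>x. ereal (pgf c x)) \<longlongrightarrow> (if summable c then ereal (suminf c) else \<infinity>)) (at_left 1)"
proof (cases "summable c")
  case True
  have "continuous_on {0..1} (pgf c)"
    unfolding pgf_def
    by (rule continuous_on_suminf_nonneg[OF True])
       (auto simp: abs_mult nonneg power_le_one mult_left_le intro!: continuous_intros)
  then have "(pgf c \<longlongrightarrow> pgf c 1) (at 1 within {0..1})"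
    by (auto simp: continuous_on_def)
  then have "(pgf c \<longlongrightarrow> pgf c 1) (at_left 1)"
    by (simp add: at_within_Icc_at_left)
  moreover have "pgf c 1 = suminf c" by (simp add: pgf_def)
  ultimately show ?thesis using True by simp
next
  case False
  have "\<forall>\<^sub>F x in at_left 1. ereal r < ereal (pgf c x)" for r
  proof -
    obtain N where N: "r < (\<Sum>n<N. c n)"
      using False summableI_nonneg_bounded[of c r] nonneg by (meson not_le)
    have "((\<lambda>x. \<Sum>n<N. c n * x ^ n) \<longlongrightarrow> (\<Sum>n<N. c n * 1 ^ n)) (at_left 1)"
      by (intro tendsto_intros)
    then have "\<forall>\<^sub>F x in at_left 1. r < (\<Sum>n<N. c n * x ^ n)"
      using N by (intro order_tendstoD(1)) auto
    moreover have "\<forall>\<^sub>F x in at_left (1::real). x \<in> {0<..<1}"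
      by (intro eventually_at_left_real) simp
    ultimately show ?thesis
    proof eventually_elim
      case (elim x)
      then have "(\<Sum>n<N. c n * x ^ n) \<le> pgf c x"
        unfolding pgf_def by (intro sum_le_suminf conv) (auto simp: nonneg)
      with elim show ?case by simp
    qed
  qed
  then show ?thesis using False by (simp add: tendsto_PInfty)
qed

text \<open>Ties the limit definition of the derivative at 1 to binomial moments. The infinite
  branch later turns finiteness of a derivative into summability.\<close>

lemma deriv_at_one_pgf:
  fixes r :: nat
  assumes nonneg: "\<And>n. 0 \<le> p n" and "summable p"
  defines "c \<equiv> \<lambda>k. p k * real (k choose r)"
  shows "deriv_at_one r (pgf p) = (if summable c then ereal (fact r * suminf c) else \<infinity>)"
proof -
  define d where "d = (diffs ^^ r) p"
  have d_eq: "d = (\<lambda>n. fact r * c (n + r))"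
    by (simp add: d_def c_def funpow_diffs fun_eq_iff)
  have "((\<lambda>x. ereal (pgf d x)) \<longlongrightarrow> (if summable d then ereal (suminf d) else \<infinity>)) (at_left 1)"
    by (rule pgf_left_limit)
       (auto simp: d_def summable_funpow_diffs assms(2), simp add: funpow_diffs nonneg)
  moreover have "\<forall>\<^sub>F x in at_left 1. ereal (pgf d x) = ereal ((deriv ^^ r) (pgf p) x)"
  proof -
    have "\<forall>\<^sub>F x in at_left (1::real). x \<in> {0<..<1}"
      by (intro eventually_at_left_real) simp
    then show ?thesis
      by eventually_elim (simp add: funpow_deriv_pgf assms(2) d_def)
  qed
  ultimately have "((\<lambda>x. ereal ((deriv ^^ r) (pgf p) x)) \<longlongrightarrow> (if summable d then ereal (suminf d) else \<infinity>)) (at_left 1)"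
    by (rule Lim_transform_eventually)
  then have "deriv_at_one r (pgf p) = (if summable d then ereal (suminf d) else \<infinity>)"
    unfolding deriv_at_one_def by (intro tendsto_Lim) auto
  moreover have "summable d \<longleftrightarrow> summable c"
    unfolding d_eq by (simp add: summable_iff_shift)
  moreover have "suminf d = fact r * suminf c" if "summable c"
  proof -
    \<comment> \<open>Differentiation shifts the index by r; nothing is lost, since
      \<open>k choose r\<close> vanishes for k < r.\<close>
    have "(\<Sum>k<r. c k) = 0" by (simp add: c_def binomial_eq_0)
    then have "(\<Sum>n. c (n + r)) = suminf c"
      using suminf_split_initial_segment[OF that, of r] by simp
    then show ?thesis
      unfolding d_eq using that by (subst suminf_mult) (auto simp: summable_iff_shift)
  qed
  ultimately show ?thesis by simp
qed

subsection \<open>Moments with a logarithm\<close>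

text \<open>\<open>harm n - ln n\<close> decreases from its value 1 at n = 1.\<close>

lemma harm_le_ln: "0 < n \<Longrightarrow> harm n \<le> ln (real n) + 1"
  using decseqD[OF decseq_harm_diff_ln, of 0 "n - 1"] by (simp add: harm_def)

lemma choose_le_Suc_choose:
  assumes "Suc j \<le> k"
  shows "k choose j \<le> Suc j * (k choose Suc j)"
proof -
  have "(k - j) * (k choose j) = Suc j * (k choose Suc j)"
    by (metis binomial_absorb_comp binomial_absorption)
  moreover have "1 * (k choose j) \<le> (k - j) * (k choose j)"
    using assms by (intro mult_right_mono) auto
  ultimately show ?thesis by simp
qed

text \<open>Yields the lower moments from the third. The comparison starts at k = j + 1, since at k
  = j the dominating coefficient \<open>k choose Suc j\<close> is 0.\<close>

lemma summable_binomial_moment_Suc: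
  fixes p :: "nat \<Rightarrow> real"
  assumes nonneg: "\<And>k. 0 \<le> p k" and sm: "summable (\<lambda>k. p k * real (k choose Suc j))"
  shows "summable (\<lambda>k. p k * real (k choose j))"
proof (rule summable_comparison_test'[where N = "Suc j"])
  show "summable (\<lambda>k. real (Suc j) * (p k * real (k choose Suc j)))"
    using sm by (rule summable_mult)
  fix k assume "Suc j \<le> k"
  from choose_le_Suc_choose[OF this]
  have "real (k choose j) \<le> real (Suc j) * real (k choose Suc j)"
    by (metis of_nat_le_iff of_nat_mult)
  from mult_left_mono[OF this nonneg[of k]]
  show "norm (p k * real (k choose j)) \<le> real (Suc j) * (p k * real (k choose Suc j))"
    using nonneg[of k] by (simp add: abs_mult mult_ac)
qed

text \<open>By \<open>tquot_int_at_1\<close> the series differ, up to a summable multiple of the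
  r-th binomial moment, only in \<open>k choose r\<close> against k^r and \<open>harm k\<close>
  against \<open>ln k\<close>; each pair is comparable.\<close>

lemma summable_tquot_int_iff:
  fixes p :: "nat \<Rightarrow> real"
  assumes nonneg: "\<And>k. 0 \<le> p k" and sm: "summable (\<lambda>k. p k * real (k choose r))" and r: "0 < r"
  shows "summable (\<lambda>k. p k * tquot_int r k 1) \<longleftrightarrow> summable (\<lambda>k. p k * real k ^ r * ln (real k))"
proof -
  have eq: "p k * tquot_int r k 1 = p k * real (k choose r) * harm k - harm r * (p k * real (k choose r))" for k
    by (simp add: tquot_int_at_1 algebra_simps)
  have "summable (\<lambda>k. p k * tquot_int r k 1) \<longleftrightarrow> summable (\<lambda>k. p k * real (k choose r) * harm k)"
  proof
    assume "summable (\<lambda>k. p k * tquot_int r k 1)"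
    from summable_add[OF this summable_mult[OF sm, of "harm r"]]
    show "summable (\<lambda>k. p k * real (k choose r) * harm k)"
      by (simp add: eq)
  next
    assume "summable (\<lambda>k. p k * real (k choose r) * harm k)"
    from summable_diff[OF this summable_mult[OF sm, of "harm r"]]
    show "summable (\<lambda>k. p k * tquot_int r k 1)"
      by (simp add: eq)
  qed
  also have "\<dots> \<longleftrightarrow> summable (\<lambda>k. p k * real k ^ r * ln (real k))"
  proof
    assume H: "summable (\<lambda>k. p k * real (k choose r) * harm k)"
    show "summable (\<lambda>k. p k * real k ^ r * ln (real k))"
    proof (rule summable_comparison_test'[where N = r])
      show "summable (\<lambda>k. real r ^ r * (p k * real (k choose r) * harm k))"
        using H by (rule summable_mult)
      fix k assume k: "r \<le> k"
      \<comment> \<open>The constant \<open>r ^ r\<close> comes from this lower bound on the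
        binomial coefficient.\<close>
      have "(real k / real r) ^ r \<le> real (k choose r)"
        using binomial_ge_n_over_k_pow_k[OF k, where 'a = real] by simp
      then have "real k ^ r \<le> real r ^ r * real (k choose r)"
        using r by (simp add: power_divide field_simps)
      moreover have "ln (real k) \<le> harm k"
        proof -
        have "ln (real k) \<le> ln (real k + 1)" using k r by simp
        also have "\<dots> \<le> harm k" by (rule ln_le_harm)
        finally show ?thesis .
      qed
      ultimately have "real k ^ r * ln (real k) \<le> (real r ^ r * real (k choose r)) * harm k"
        using k r by (intro mult_mono) auto
      from mult_left_mono[OF this nonneg[of k]]
      show "norm (p k * real k ^ r * ln (real k)) \<le> real r ^ r * (p k * real (k choose r) * harm k)"
        using nonneg[of k] k r by (simp add: abs_mult mult_ac)
    qed
  next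
    assume H: "summable (\<lambda>k. p k * real k ^ r * ln (real k))"
    show "summable (\<lambda>k. p k * real (k choose r) * harm k)"
    proof (rule summable_comparison_test'[where N = r])
      \<comment> \<open>The second summand absorbs the 1 in
        \<open>harm k \<le> ln k + 1\<close>.\<close>
      show "summable (\<lambda>k. p k * real k ^ r * ln (real k) + p k * real (k choose r))"
        using H sm by (rule summable_add)
      fix k assume k: "r \<le> k"
      have "real (k choose r) * harm k \<le> real (k choose r) * (ln (real k) + 1)"
        using harm_le_ln[of k] k r by (intro mult_left_mono) auto
      also have "\<dots> \<le> real k ^ r * ln (real k) + real (k choose r)"
      proof -
        have "real (k choose r) \<le> real k ^ r"
          using binomial_le_pow[OF k] by (metis of_nat_le_iff of_nat_power)
        from mult_right_mono[OF this, of "ln (real k)"] k r show ?thesis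
          by (simp add: algebra_simps)
      qed
      finally have "real (k choose r) * harm k \<le> real k ^ r * ln (real k) + real (k choose r)" .
      from mult_left_mono[OF this nonneg[of k]]
      show "norm (p k * real (k choose r) * harm k) \<le> p k * real k ^ r * ln (real k) + p k * real (k choose r)"
        using nonneg[of k] by (simp add: abs_mult harm_nonneg algebra_simps)
    qed
  qed
  finally show ?thesis .
qed

subsection \<open>Slow variation\<close>

lemma interval_integral_eq_integral_of_continuous:
  assumes "continuous_on {0..<1} (h :: real \<Rightarrow> real)" "0 < x" "x \<le> 1"
  shows "(LBINT s=ereal 0..ereal (1 - x). h s) = integral {0..1 - x} h"
  using assms
  by (intro interval_integral_eq_integral borel_integrable_atLeastAtMost' continuous_on_subset[OF assms(1)]) auto

lemma slowly_varying_exp_integral: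
  fixes h :: "real \<Rightarrow> real"
  assumes cont: "continuous_on {0..<1} h"
    and lim: "((\<lambda>x. x * h (1 - x)) \<longlongrightarrow> 0) (at_right 0)"
  shows "slowly_varying_at_zero (\<lambda>x. exp (LBINT s=ereal 0..ereal (1 - x). h s))"
proof -
  define J where "J x = (LBINT s=ereal 0..ereal (1 - x). h s)" for x
  have J_deriv: "(J has_real_derivative - h (1 - x)) (at x)" if x: "0 < x" "x < 1" for x
  proof -
    \<comment> \<open>The right endpoint \<open>1 - x / 2\<close> makes \<open>1 - x\<close>
      interior, so the derivative becomes two-sided, while the interval stays inside [0, 1).\<close>
    have "((\<lambda>t. integral {0..t} h) has_real_derivative h (1 - x)) (at (1 - x) within {0..1 - x / 2})"
      using x by (intro integral_has_real_derivative continuous_on_subset[OF cont]) auto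
    then have "((\<lambda>t. integral {0..t} h) has_real_derivative h (1 - x)) (at (1 - x))"
      using x by (subst (asm) at_within_Icc_at) auto
    moreover have "((\<lambda>x. 1 - x) has_real_derivative - 1) (at x)"
      by (auto intro!: derivative_eq_intros)
    ultimately have "((\<lambda>x. integral {0..1 - x} h) has_real_derivative h (1 - x) * - 1) (at x)"
      by (rule DERIV_chain2)
    then have "((\<lambda>x. integral {0..1 - x} h) has_real_derivative - h (1 - x)) (at x)"
      by simp
    then show ?thesis
      by (rule has_field_derivative_transform_within_open[where S = "{0<..<1}"])
         (use x in \<open>auto simp: J_def interval_integral_eq_integral_of_continuous[OF cont]\<close>)
  qed
  have "((\<lambda>x. J (c * x) - J x) \<longlongrightarrow> 0) (at_right 0)" if c: "c > 0" for c
  proof (rule tendstoI)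
    fix e :: real assume e: "e > 0"
    \<comment> \<open>The interval from m x to M x contains both x and c x, and K is the ratio of |c
      x - x| to m x.\<close>
    define m where "m = min c 1"
    define M where "M = max c 1"
    define K where "K = \<bar>c - 1\<bar> / m"
    have mM: "0 < m" "m \<le> 1" "m \<le> c" "1 \<le> M" "c \<le> M"
      using c by (auto simp: m_def M_def)
    have K: "0 \<le> K" using mM by (simp add: K_def)
    define d where "d = e / (K + 1)"
    have d: "d > 0" "d * K < e"
      using e K by (auto simp: d_def field_simps)
    have "\<forall>\<^sub>F y in at_right 0. \<bar>y * h (1 - y)\<bar> < d"
      using tendstoD[OF lim d(1)] by simp
    then obtain b where b: "b > 0" "\<And>y. 0 < y \<Longrightarrow> y < b \<Longrightarrow> \<bar>y * h (1 - y)\<bar> < d"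
      by (auto simp: eventually_at_right_field)
    define u where "u = min b 1 / M"
    have "\<forall>\<^sub>F x in at_right 0. x \<in> {0<..<u}"
      using b(1) mM by (intro eventually_at_right_real) (auto simp: u_def)
    then show "\<forall>\<^sub>F x in at_right 0. dist (J (c * x) - J x) 0 < e"
    proof eventually_elim
      case (elim x)
      then have x: "0 < x" "M * x < b" "M * x < 1"
        using mM by (auto simp: u_def field_simps)
      have mx: "0 < m * x" using mM x by simp
      \<comment> \<open>Mean value inequality: on the interval, |h (1 - y)| is at most d / y, hence
        at most d / (m x).\<close>
      have "norm (J (c * x) - J x) \<le> d / (m * x) * norm (c * x - x)"
      proof (rule field_differentiable_bound[where S = "{m * x..M * x}" and f' = "\<lambda>y. - h (1 - y)"])
        fix y assume y: "y \<in> {m * x..M * x}"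
        then have y': "0 < y" "y < b" "y < 1" using mx x by auto
        show "(J has_real_derivative - h (1 - y)) (at y within {m * x..M * x})"
          using J_deriv[OF y'(1,3)] by (rule has_field_derivative_at_within)
        have "\<bar>h (1 - y)\<bar> \<le> d / y"
          using b(2)[OF y'(1,2)] y'(1) by (simp add: abs_mult field_simps)
        also have "\<dots> \<le> d / (m * x)"
          using y d(1) mx by (intro divide_left_mono) auto
        finally show "norm (- h (1 - y)) \<le> d / (m * x)" by simp
      qed (use mM x in auto)
      also have "norm (c * x - x) = \<bar>c - 1\<bar> * x"
        using x(1) abs_mult[of "c - 1" x] by (simp add: algebra_simps)
      also have "d / (m * x) * (\<bar>c - 1\<bar> * x) = d * K"
        using x(1) by (simp add: K_def)
      finally show ?case using d(2) by simp
    qed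
  qed
  then have "((\<lambda>x. exp (J (c * x) - J x)) \<longlongrightarrow> exp 0) (at_right 0)" if "c > 0" for c
    using that by (intro tendsto_exp)
  then show ?thesis
    by (simp add: slowly_varying_at_zero_def exp_diff flip: J_def)
qed

text \<open>Comparison on a set of measure 1, so the constant \<open>M\<close> contributes a finite
  amount; continuity of \<open>h\<close> supplies measurability. It serves both directions of the
  integrability equivalence.\<close>

lemma set_nn_integral_finite_bound:
  fixes g h :: "real \<Rightarrow> real"
  assumes cont: "continuous_on {0..<1} h" and nonneg: "\<And>x. x \<in> {0..<1} \<Longrightarrow> 0 \<le> h x"
    and bound: "\<And>x. x \<in> {0..<1} \<Longrightarrow> g x \<le> M + c * h x" and Mc: "0 \<le> M" "0 \<le> c"
    and fin: "(\<integral>\<^sup>+x\<in>{0..<1}. ennreal (h x) \<partial>lborel) < \<infinity>"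
  shows "(\<integral>\<^sup>+x\<in>{0..<1}. ennreal (g x) \<partial>lborel) < \<infinity>"
proof -
  have "(\<lambda>x. ennreal (indicator {0..<1} x *\<^sub>R h x)) \<in> borel_measurable lborel"
    using borel_measurable_continuous_on_indicator[OF _ cont] by simp
  also have "(\<lambda>x. ennreal (indicator {0..<1} x *\<^sub>R h x)) = (\<lambda>x. ennreal (h x) * indicator {0..<1} x)"
    by (auto simp: fun_eq_iff indicator_def)
  finally have meas: "(\<lambda>x. ennreal (h x) * indicator {0..<1} x) \<in> borel_measurable lborel" .
  have "(\<integral>\<^sup>+x\<in>{0..<1}. ennreal (g x) \<partial>lborel)
      \<le> (\<integral>\<^sup>+x. ennreal M * indicator {0..<1} x + ennreal c * (ennreal (h x) * indicator {0..<1} x) \<partial>lborel)"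
  proof (intro nn_integral_mono)
    fix x :: real
    show "ennreal (g x) * indicator {0..<1} x
        \<le> ennreal M * indicator {0..<1} x + ennreal c * (ennreal (h x) * indicator {0..<1} x)"
    proof (cases "x \<in> {0..<1}")
      case True
      then have "ennreal (g x) \<le> ennreal (M + c * h x)"
        by (intro ennreal_leI bound)
      also have "\<dots> = ennreal M + ennreal c * ennreal (h x)"
        using True Mc nonneg by (simp add: ennreal_plus ennreal_mult)
      finally show ?thesis using True by simp
    qed simp
  qed
  also have "\<dots> = ennreal M * emeasure lborel {0..<1::real}
      + ennreal c * (\<integral>\<^sup>+x\<in>{0..<1}. ennreal (h x) \<partial>lborel)"
    using meas by (subst nn_integral_add) (auto simp: nn_integral_cmult nn_integral_cmult_indicator)
  also have "\<dots> < \<infinity>"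
    using fin by (simp add: ennreal_mult_less_top)
  finally show ?thesis .
qed

subsection \<open>Critical laws with a third moment\<close>

locale critical_law =
  fixes p :: "nat \<Rightarrow> real"
  assumes nonneg: "\<And>k. 0 \<le> p k"
    and summable_p: "summable p"
    and sum_p: "suminf p = 1"
    and mean_p: "(\<Sum>k. p k * real k) = 1"
    and third_moment: "summable (\<lambda>k. p k * real (k choose 3))"
    and nontrivial: "p 1 \<noteq> 1"
begin

section \<open>Binomial moments and the series of Taylor quotients\<close>

definition S :: "nat \<Rightarrow> real" where
  "S j = (\<Sum>k. p k * real (k choose j))"

text \<open>For j = 1, 2, 3 these turn out to be \<open>f3\<close>, \<open>f4\<close>,
  \<open>f5\<close> on [0, 1).\<close>

definition F :: "nat \<Rightarrow> real \<Rightarrow> real" where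
  "F j x = (\<Sum>k. p k * tquot j k x)"

lemma summable_S: "j \<le> 3 \<Longrightarrow> summable (\<lambda>k. p k * real (k choose j))"
proof -
  have 2: "summable (\<lambda>k. p k * real (k choose 2))"
    by (rule summable_binomial_moment_Suc) (use nonneg third_moment in \<open>auto simp: eval_nat_numeral\<close>)
  have 1: "summable (\<lambda>k. p k * real (k choose 1))"
    by (rule summable_binomial_moment_Suc) (use nonneg 2 in \<open>auto simp: eval_nat_numeral\<close>)
  assume "j \<le> 3"
  then consider "j = 0" | "j = 1" | "j = 2" | "j = 3" by linarith
  then show ?thesis using 1 2 third_moment summable_p by cases auto
qed

lemma deriv_at_one_eq: "j \<le> 3 \<Longrightarrow> deriv_at_one j (pgf p) = ereal (fact j * S j)"
  using deriv_at_one_pgf[OF nonneg summable_p, of j] summable_S[of j] by (simp add: S_def)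

lemma m2_eq: "m2 (pgf p) = S 2" and m3_eq: "m3 (pgf p) = S 3"
  by (simp_all add: m2_def m3_def deriv_at_one_eq fact_numeral)

lemma S_1: "S (Suc 0) = 1"
  by (simp add: S_def mean_p)

text \<open>A law carried by {0, 1} has mean \<open>p 1\<close>, so mean 1 would force the excluded
  case \<open>p 1 = 1\<close>.\<close>

lemma obtain_atom:
  obtains k where "2 \<le> k" "0 < p k"
proof -
  have "\<exists>k\<ge>2. p k \<noteq> 0"
  proof (rule ccontr)
    assume "\<not> ?thesis"
    then have *: "k < 2 \<or> p k = 0" for k
      using not_le by blast
    have "p k * real k = (if k = 1 then p 1 else 0)" for k
      using *[of k] by (auto simp: less_2_cases_iff)
    then have "(\<Sum>k. p k * real k) = p 1"
      using sums_single[of 1 "\<lambda>_. p 1"] by (simp add: sums_iff)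
    then show False using mean_p nontrivial by simp
  qed
  then show ?thesis using that nonneg by (metis order_le_imp_less_or_eq)
qed

lemma S_2_pos: "0 < S 2"
proof -
  obtain k where k: "2 \<le> k" "0 < p k" by (rule obtain_atom)
  have "0 < p k * real (k choose 2)" using k by simp
  also have "\<dots> = (\<Sum>i\<in>{k}. p i * real (i choose 2))" by simp
  also have "\<dots> \<le> S 2"
    unfolding S_def by (intro sum_le_suminf summable_S) (auto simp: nonneg)
  finally show ?thesis .
qed

lemma summable_F:
  assumes "j \<le> 2" "0 \<le> x" "x \<le> 1"
  shows "summable (\<lambda>k. p k * tquot j k x)"
proof (rule summable_comparison_test'[where N = 0])
  show "summable (\<lambda>k. p k * real (k choose Suc j))" using assms by (intro summable_S) auto
  show "norm (p k * tquot j k x) \<le> p k * real (k choose Suc j)" for k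
    using assms nonneg[of k] tquot_le[of x j k] by (simp add: abs_mult tquot_nonneg mult_left_mono)
qed

text \<open>Dividing termwise by 1 - x proves convergence along with the value. For j = 2 this
  reaches \<open>tquot 3\<close> on x < 1, where domination by the value at 1 would require a fourth
  moment.\<close>

lemma F_sums_step:
  assumes "j \<le> 2" "0 \<le> x" "x < 1"
  shows "(\<lambda>k. p k * tquot (Suc j) k x) sums ((S (Suc j) - F j x) / (1 - x))"
proof -
  have "(\<lambda>k. p k * real (k choose Suc j) - p k * tquot j k x) sums (S (Suc j) - F j x)"
    unfolding S_def F_def
    using assms by (intro sums_diff summable_sums summable_S summable_F) auto
  then have "(\<lambda>k. (p k * real (k choose Suc j) - p k * tquot j k x) / (1 - x)) sums ((S (Suc j) - F j x) / (1 - x))"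
    by (rule sums_divide)
  also have "(\<lambda>k. (p k * real (k choose Suc j) - p k * tquot j k x) / (1 - x)) = (\<lambda>k. p k * tquot (Suc j) k x)"
    using assms by (simp add: fun_eq_iff divide_eq_eq tquot_step[symmetric] flip: right_diff_distrib)
  finally show ?thesis .
qed

lemma F_step: "j \<le> 2 \<Longrightarrow> 0 \<le> x \<Longrightarrow> x < 1 \<Longrightarrow> F (Suc j) x = (S (Suc j) - F j x) / (1 - x)"
  using F_sums_step[of j x] by (simp add: F_def sums_iff)

lemma F_3_eq: "0 \<le> x \<Longrightarrow> x < 1 \<Longrightarrow> F 3 x = (S 3 - F 2 x) / (1 - x)"
  using F_step[of 2 x] by (simp add: eval_nat_numeral)

lemma summable_F_3: "0 \<le> x \<Longrightarrow> x < 1 \<Longrightarrow> summable (\<lambda>k. p k * tquot 3 k x)"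
  using F_sums_step[of 2 x] by (simp add: sums_iff eval_nat_numeral)

lemma F_zeroth:
  assumes "0 \<le> x" "x < 1"
  shows "F 0 x = (1 - pgf p x) / (1 - x)"
proof -
  have sm: "summable (\<lambda>k. p k * x ^ k)"
    using powser_inside[of p 1 x] summable_p assms by simp
  have "(\<lambda>k. (p k - p k * x ^ k) / (1 - x)) sums ((suminf p - pgf p x) / (1 - x))"
    unfolding pgf_def by (intro sums_divide sums_diff summable_sums sm summable_p)
  also have "(\<lambda>k. (p k - p k * x ^ k) / (1 - x)) = (\<lambda>k. p k * tquot 0 k x)"
  proof
    fix k
    have "p k - p k * x ^ k = p k * ((1 - x) * tquot 0 k x)"
      by (simp only: tquot_zeroth) (simp add: algebra_simps)
    then show "(p k - p k * x ^ k) / (1 - x) = p k * tquot 0 k x"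
      using assms by simp
  qed
  finally show ?thesis by (simp add: F_def sums_iff sum_p)
qed

section \<open>Identification with \<open>f3\<close>, \<open>f4\<close>, \<open>f5\<close>;
  continuity and positivity\<close>

lemma f3_eq: "0 \<le> x \<Longrightarrow> x < 1 \<Longrightarrow> f3 (pgf p) x = F 1 x"
proof -
  assume x: "0 \<le> x" "x < 1"
  \<comment> \<open>Criticality enters here: the leading 1 is the mean \<open>S 1\<close>.\<close>
  have "F 1 x = (1 - (1 - pgf p x) / (1 - x)) / (1 - x)"
    using F_step[of 0 x] x by (simp add: S_1 F_zeroth)
  also have "\<dots> = f3 (pgf p) x"
    using x by (simp add: f3_def power2_eq_square diff_divide_eq_iff)
  finally show ?thesis by simp
qed

lemma f4_eq: "0 \<le> x \<Longrightarrow> x < 1 \<Longrightarrow> f4 (pgf p) x = F 2 x"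
  using F_step[of 1 x] by (simp add: f4_def f3_eq m2_eq numeral_2_eq_2)

lemma f5_eq: "0 \<le> x \<Longrightarrow> x < 1 \<Longrightarrow> f5 (pgf p) x = F 3 x"
  by (simp add: f5_def f4_eq m3_eq F_3_eq)

lemma continuous_on_F: "j \<le> 2 \<Longrightarrow> continuous_on {0..1} (F j)"
  unfolding F_def
  by (rule continuous_on_suminf_nonneg[where M = "\<lambda>k. p k * real (k choose Suc j)"])
     (auto simp: abs_mult nonneg tquot_nonneg tquot_le mult_left_mono intro!: summable_S continuous_intros)

lemma continuous_on_F_3: "continuous_on {0..<1} (F 3)"
proof -
  have "continuous_on {0..<1} (\<lambda>x. (S 3 - F 2 x) / (1 - x))"
    by (intro continuous_intros continuous_on_subset[OF continuous_on_F]) auto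
  then show ?thesis
    by (rule continuous_on_eq) (simp add: F_3_eq)
qed

lemma F_at_1: "F j 1 = S (Suc j)"
  by (simp add: F_def S_def tquot_at_1)

lemma F_1_pos:
  assumes "0 \<le> x" "x \<le> 1"
  shows "0 < F 1 x"
proof -
  obtain k where k: "2 \<le> k" "0 < p k" by (rule obtain_atom)
  \<comment> \<open>At 0 only the constant term k - 1 survives, positive for k at least 2.\<close>
  have "0 < tquot 1 k 0"
    using k by (simp add: tquot_def sum.lessThan_Suc_shift power_0_left if_distrib sum.delta cong: if_cong)
  also have "\<dots> \<le> tquot 1 k x" using assms by (intro tquot_mono) auto
  finally have "0 < p k * tquot 1 k x" using k by simp
  also have "\<dots> = (\<Sum>i\<in>{k}. p i * tquot 1 i x)" by simp
  also have "\<dots> \<le> F 1 x"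
    unfolding F_def using assms
    by (intro sum_le_suminf summable_F) (auto simp: nonneg tquot_nonneg)
  finally show ?thesis .
qed

section \<open>The bounded summand of \<open>psi11\<close>\<close>

definition ratio :: "real \<Rightarrow> real" where
  "ratio x = (F 2 x)\<^sup>2 / ((S 2)\<^sup>2 * F 1 x)"

lemma continuous_on_ratio: "continuous_on {0..1} ratio"
proof -
  have "(S 2)\<^sup>2 * F 1 x \<noteq> 0" if "x \<in> {0..1}" for x
    using F_1_pos[of x] S_2_pos that by simp
  then show ?thesis
    unfolding ratio_def by (intro continuous_on_divide continuous_on_mult continuous_on_power
      continuous_on_const continuous_on_F) auto
qed

lemma psi11_eq: "0 \<le> x \<Longrightarrow> x < 1 \<Longrightarrow> psi11 (pgf p) x = ratio x - F 3 x / (S 2)\<^sup>2"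
  by (simp add: psi11_def ratio_def f3_eq f4_eq f5_eq m2_eq)

lemma continuous_on_psi11: "continuous_on {0..<1} (psi11 (pgf p))"
proof -
  have "continuous_on {0..<1} (\<lambda>x. ratio x - F 3 x / (S 2)\<^sup>2)"
    using S_2_pos
    by (intro continuous_intros continuous_on_F_3 continuous_on_subset[OF continuous_on_ratio]) auto
  then show ?thesis
    by (rule continuous_on_eq) (simp add: psi11_eq)
qed

lemma ratio_bounded:
  obtains M where "0 \<le> M" "\<And>x. 0 \<le> x \<Longrightarrow> x \<le> 1 \<Longrightarrow> \<bar>ratio x\<bar> \<le> M"
proof -
  have "bounded (ratio ` {0..1})"
    by (intro compact_imp_bounded compact_continuous_image continuous_on_ratio compact_Icc)
  then obtain M where "\<forall>x\<in>{0..1}. \<bar>ratio x\<bar> \<le> M"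
    by (auto simp: bounded_iff)
  show ?thesis
  proof (rule that[of "max M 0", rotated])
    show "\<bar>ratio x\<bar> \<le> max M 0" if "0 \<le> x" "x \<le> 1" for x
      using \<open>\<forall>x\<in>{0..1}. \<bar>ratio x\<bar> \<le> M\<close> that by (simp add: max.coboundedI1)
  qed simp
qed

section \<open>Integrability of \<open>psi11\<close> and the logarithmic moment\<close>

lemma F_3_nonneg: "0 \<le> x \<Longrightarrow> x < 1 \<Longrightarrow> 0 \<le> F 3 x"
  unfolding F_def
  by (intro suminf_nonneg summable_F_3) (auto simp: nonneg tquot_nonneg)

lemma nn_integral_F_3:
  "(\<integral>\<^sup>+x\<in>{0..<1}. ennreal (F 3 x) \<partial>lborel) = (\<Sum>k. ennreal (p k * tquot_int 3 k 1))"
proof -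
  have "(\<integral>\<^sup>+x\<in>{0..<1}. ennreal (F 3 x) \<partial>lborel)
      = (\<integral>\<^sup>+x. (\<Sum>k. ennreal (p k) * (ennreal (tquot 3 k x) * indicator {0..<1} x)) \<partial>lborel)"
  proof (intro nn_integral_cong)
    fix x :: real
    show "ennreal (F 3 x) * indicator {0..<1} x = (\<Sum>k. ennreal (p k) * (ennreal (tquot 3 k x) * indicator {0..<1} x))"
    proof (cases "x \<in> {0..<1}")
      case True
      then have "summable (\<lambda>k. p k * tquot 3 k x)"
        by (intro summable_F_3) auto
      then have "(\<Sum>k. ennreal (p k * tquot 3 k x)) = ennreal (F 3 x)"
        unfolding F_def using True
        by (intro suminf_ennreal2) (auto simp: nonneg tquot_nonneg)
      then show ?thesis using True by (simp add: ennreal_mult' nonneg)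
    qed simp
  qed
  also have "\<dots> = (\<Sum>k. \<integral>\<^sup>+x. ennreal (p k) * (ennreal (tquot 3 k x) * indicator {0..<1} x) \<partial>lborel)"
    by (intro nn_integral_suminf borel_measurable_times_ennreal measurable_compose[OF _ measurable_ennreal])
       (auto intro: borel_measurable_continuous_onI continuous_on_tquot)
  also have "\<dots> = (\<Sum>k. ennreal (p k * tquot_int 3 k 1))"
  proof (intro suminf_cong)
    fix k
    have "(\<integral>\<^sup>+x. ennreal (p k) * (ennreal (tquot 3 k x) * indicator {0..<1} x) \<partial>lborel)
        = ennreal (p k) * (\<integral>\<^sup>+x\<in>{0..<1}. ennreal (tquot 3 k x) \<partial>lborel)"
      by (intro nn_integral_cmult borel_measurable_times_ennreal measurable_compose[OF _ measurable_ennreal])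
         (auto intro: borel_measurable_continuous_onI continuous_on_tquot)
    then show "(\<integral>\<^sup>+x. ennreal (p k) * (ennreal (tquot 3 k x) * indicator {0..<1} x) \<partial>lborel)
        = ennreal (p k * tquot_int 3 k 1)"
      by (simp add: nn_integral_tquot ennreal_mult' nonneg)
  qed
  finally show ?thesis .
qed

text \<open>Nonnegative terms make sequential and unordered summability agree; the terms k = 0 and k
  = 1 are zero, so the sum may start at 2.\<close>

lemma summable_ln_iff:
  "summable (\<lambda>k. p k * tquot_int 3 k 1) \<longleftrightarrow> (\<lambda>k. p k * real k ^ 3 * ln (real k)) summable_on {2..}"
proof -
  have "0 \<le> p k * real k ^ 3 * ln (real k)" for k
    by (cases "k = 0") (simp_all add: nonneg)
  then have "summable (\<lambda>k. p k * real k ^ 3 * ln (real k)) \<longleftrightarrow> (\<lambda>k. p k * real k ^ 3 * ln (real k)) summable_on UNIV"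
    by (intro summable_on_UNIV_nonneg_real_iff[symmetric])
  also have "\<dots> \<longleftrightarrow> (\<lambda>k. p k * real k ^ 3 * ln (real k)) summable_on {2..}"
    by (intro summable_on_cong_neutral) (auto simp: not_le less_2_cases_iff)
  finally show ?thesis
    using summable_tquot_int_iff[of p 3] nonneg third_moment by simp
qed

lemma nn_integral_F_3_finite_iff:
  "(\<integral>\<^sup>+x\<in>{0..<1}. ennreal (F 3 x) \<partial>lborel) < \<infinity> \<longleftrightarrow> summable (\<lambda>k. p k * tquot_int 3 k 1)"
proof -
  have "0 \<le> p k * tquot_int 3 k 1" for k by (simp add: nonneg tquot_int_nonneg)
  then show ?thesis
    unfolding nn_integral_F_3 infinity_ennreal_def less_top[symmetric]
    using ennreal_suminf_neq_top[of "\<lambda>k. p k * tquot_int 3 k 1"]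
      summable_suminf_not_top[of "\<lambda>k. p k * tquot_int 3 k 1"]
    by blast
qed

text \<open>\<open>F 3 x / (S 2)^2\<close> and |psi11| differ by at most the bound on
  \<open>ratio\<close>, so each dominates the other up to constants.\<close>

lemma nn_integral_psi11_finite_iff:
  "(\<integral>\<^sup>+x\<in>{0..<1}. ennreal \<bar>psi11 (pgf p) x\<bar> \<partial>lborel) < \<infinity> \<longleftrightarrow>
     (\<integral>\<^sup>+x\<in>{0..<1}. ennreal (F 3 x) \<partial>lborel) < \<infinity>" (is "?L < _ \<longleftrightarrow> ?R < _")
proof
  obtain M where M: "0 \<le> M" "\<And>x. 0 \<le> x \<Longrightarrow> x \<le> 1 \<Longrightarrow> \<bar>ratio x\<bar> \<le> M"
    by (rule ratio_bounded) blast
  {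
    assume fin: "?L < \<infinity>"
    show "?R < \<infinity>"
    proof (rule set_nn_integral_finite_bound[OF _ _ _ _ _ fin])
      fix x :: real assume x: "x \<in> {0..<1}"
      have "F 3 x / (S 2)\<^sup>2 \<le> M + \<bar>psi11 (pgf p) x\<bar>"
        using x M(2)[of x] by (simp add: psi11_eq)
      then show "F 3 x \<le> (S 2)\<^sup>2 * M + (S 2)\<^sup>2 * \<bar>psi11 (pgf p) x\<bar>"
        using S_2_pos by (simp add: field_simps)
    qed (use M in \<open>auto intro!: continuous_intros continuous_on_psi11\<close>)
  next
    assume fin: "?R < \<infinity>"
    show "?L < \<infinity>"
    proof (rule set_nn_integral_finite_bound[OF _ _ _ _ _ fin])
      fix x :: real assume x: "x \<in> {0..<1}"
      have "0 \<le> F 3 x / (S 2)\<^sup>2" using x by (simp add: F_3_nonneg)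
      then show "\<bar>psi11 (pgf p) x\<bar> \<le> M + 1 / (S 2)\<^sup>2 * F 3 x"
        using x M(2)[of x] by (simp add: psi11_eq)
    qed (use M in \<open>auto intro!: continuous_on_F_3 F_3_nonneg\<close>)
  }
qed

section \<open>Limits at 0 for \<open>L11\<close>\<close>

lemma slowly_varying_L11: "slowly_varying_at_zero (L11 (pgf p))"
proof -
  have F_lim: "(F 2 \<longlongrightarrow> S 3) (at_left 1)"
  proof -
    have "(F 2 \<longlongrightarrow> F 2 1) (at 1 within {0..1})"
      using continuous_on_F[of 2] by (auto simp: continuous_on_def)
    then show ?thesis by (simp add: at_within_Icc_at_left F_at_1 eval_nat_numeral)
  qed
  have ratio_lim: "(ratio \<longlongrightarrow> ratio 1) (at_left 1)"
  proof -
    have "(ratio \<longlongrightarrow> ratio 1) (at 1 within {0..1})"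
      using continuous_on_ratio by (auto simp: continuous_on_def)
    then show ?thesis by (simp add: at_within_Icc_at_left)
  qed
  \<comment> \<open>The expression is \<open>(1 - x) * psi11\<close>: the factor 1 - x cancels the
    denominator of \<open>F 3\<close>. It tends to 0 because \<open>F 2\<close> is continuous at 1
    with value \<open>S 3\<close>.\<close>
  have "((\<lambda>x. (1 - x) * ratio x - (S 3 - F 2 x) / (S 2)\<^sup>2) \<longlongrightarrow> (1 - 1) * ratio 1 - (S 3 - S 3) / (S 2)\<^sup>2) (at_left 1)"
    using S_2_pos by (intro tendsto_intros F_lim ratio_lim) auto
  moreover have "\<forall>\<^sub>F x in at_left (1::real). x \<in> {0<..<1}"
    by (intro eventually_at_left_real) simp
  then have "\<forall>\<^sub>F x in at_left 1. (1 - x) * ratio x - (S 3 - F 2 x) / (S 2)\<^sup>2 = (1 - x) * psi11 (pgf p) x"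
  proof eventually_elim
    case (elim x)
    then have *: "S 3 - F 2 x = (1 - x) * F 3 x"
      by (simp add: F_3_eq)
    show ?case
      unfolding * using elim by (simp add: psi11_eq right_diff_distrib)
  qed
  ultimately have "((\<lambda>x. (1 - x) * psi11 (pgf p) x) \<longlongrightarrow> 0) (at_left 1)"
    by (simp add: Lim_transform_eventually)
  then have "((\<lambda>x. x * psi11 (pgf p) (1 - x)) \<longlongrightarrow> 0) (at_right 0)"
    by (simp add: at_left_minus filterlim_filtermap filtermap_filtermap at_right_to_0[of "-1"] minus_diff_commute
       algebra_simps)
  from slowly_varying_exp_integral[OF continuous_on_psi11 this]
  show ?thesis by (simp add: L11_def[abs_def])
qed

text \<open>Below, \<open>F 3\<close> is minorized by its polynomial partial sums, whose integrals
  over [0, 1] are unbounded in N by divergence; \<open>ratio\<close> contributes at most M.\<close>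

lemma L11_tendsto_0:
  assumes "\<not> summable (\<lambda>k. p k * tquot_int 3 k 1)"
  shows "(L11 (pgf p) \<longlongrightarrow> 0) (at_right 0)"
proof -
  obtain M where M: "0 \<le> M" "\<And>x. 0 \<le> x \<Longrightarrow> x \<le> 1 \<Longrightarrow> \<bar>ratio x\<bar> \<le> M"
    by (rule ratio_bounded) blast
  define G where "G N x = (\<Sum>k<N. p k * tquot_int 3 k x)" for N x
  have bound: "integral {0..t} (psi11 (pgf p)) \<le> M - G N t / (S 2)\<^sup>2" if t: "0 \<le> t" "t < 1" for N t
  proof -
    have "((\<lambda>x. M - (\<Sum>k<N. p k * tquot 3 k x) / (S 2)\<^sup>2) has_integral
        (M * t - G N t / (S 2)\<^sup>2) - (M * 0 - G N 0 / (S 2)\<^sup>2)) {0..t}"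
    proof (rule fundamental_theorem_of_calculus[OF t(1)])
      fix x assume "x \<in> {0..t}"
      have "((\<lambda>x. M * x - G N x / (S 2)\<^sup>2) has_real_derivative
          M - (\<Sum>k<N. p k * tquot 3 k x) / (S 2)\<^sup>2) (at x within {0..t})"
        unfolding G_def
        by (intro DERIV_diff DERIV_cmult_Id DERIV_cdivide DERIV_sum DERIV_cmult has_real_derivative_tquot_int)
      then show "((\<lambda>x. M * x - G N x / (S 2)\<^sup>2) has_vector_derivative
          M - (\<Sum>k<N. p k * tquot 3 k x) / (S 2)\<^sup>2) (at x within {0..t})"
        by (simp add: has_real_derivative_iff_has_vector_derivative)
    qed
    moreover have "psi11 (pgf p) integrable_on {0..t}"
      using t by (intro integrable_continuous_real continuous_on_subset[OF continuous_on_psi11]) auto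
    moreover have "psi11 (pgf p) x \<le> M - (\<Sum>k<N. p k * tquot 3 k x) / (S 2)\<^sup>2" if x: "x \<in> {0..t}" for x
    proof -
      have "(\<Sum>k<N. p k * tquot 3 k x) \<le> F 3 x"
        unfolding F_def using x t
        by (intro sum_le_suminf summable_F_3) (auto simp: nonneg tquot_nonneg)
      then have "(\<Sum>k<N. p k * tquot 3 k x) / (S 2)\<^sup>2 \<le> F 3 x / (S 2)\<^sup>2"
        by (intro divide_right_mono) auto
      then show ?thesis using x t M(2)[of x] by (simp add: psi11_eq)
    qed
    ultimately have "integral {0..t} (psi11 (pgf p))
        \<le> (M * t - G N t / (S 2)\<^sup>2) - (M * 0 - G N 0 / (S 2)\<^sup>2)"
      by (intro has_integral_le[OF integrable_integral])
    also have "\<dots> = M * t - G N t / (S 2)\<^sup>2"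
      by (simp add: G_def)
    also have "\<dots> \<le> M - G N t / (S 2)\<^sup>2"
      using t M(1) by (simp add: mult_left_le)
    finally show ?thesis .
  qed
  have "filterlim (\<lambda>x. LBINT s=ereal 0..ereal (1 - x). psi11 (pgf p) s) at_bot (at_right 0)"
    unfolding filterlim_at_bot
  proof
    fix Z :: real
    \<comment> \<open>N is fixed first, from the unbounded partial sums at 1; only then does the
      upper limit 1 - x tend to 1, with \<open>G N\<close> continuous there.\<close>
    obtain N where "(M - Z) * (S 2)\<^sup>2 < G N 1"
      unfolding G_def using assms summableI_nonneg_bounded[of "\<lambda>k. p k * tquot_int 3 k 1"]
      by (meson nonneg tquot_int_nonneg mult_nonneg_nonneg not_le zero_le_one)
    then have "M - G N 1 / (S 2)\<^sup>2 < Z"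
      using S_2_pos by (simp add: field_simps)
    moreover have "((\<lambda>x. M - G N (1 - x) / (S 2)\<^sup>2) \<longlongrightarrow> M - G N (1 - 0) / (S 2)\<^sup>2) (at_right 0)"
      unfolding G_def using S_2_pos
      by (intro tendsto_intros continuous_on_tendsto_compose[OF continuous_on_tquot_int[of UNIV]]) auto
    ultimately have "\<forall>\<^sub>F x in at_right 0. M - G N (1 - x) / (S 2)\<^sup>2 < Z"
      by (intro order_tendstoD(2)) auto
    moreover have "\<forall>\<^sub>F x in at_right (0::real). x \<in> {0<..<1}"
      by (intro eventually_at_right_real) simp
    ultimately show "\<forall>\<^sub>F x in at_right 0. (LBINT s=ereal 0..ereal (1 - x). psi11 (pgf p) s) \<le> Z"
    proof eventually_elim
      case (elim x)
      then show ?case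
        using bound[of "1 - x" N] by (simp add: interval_integral_eq_integral_of_continuous[OF continuous_on_psi11])
    qed
  qed
  then show ?thesis
    unfolding L11_def[abs_def] by (rule filterlim_compose[OF exp_at_bot])
qed

end

theorem proposition15:
  fixes p :: "nat \<Rightarrow> real"
  assumes "\<And>k. p k \<ge> 0"
    and "summable p"
    and "pgf p 1 = 1"
    and "deriv_at_one 1 (pgf p) = 1"
    and "deriv_at_one 3 (pgf p) < \<infinity>"
    and "p 1 \<noteq> 1"
  shows "((\<integral>\<^sup>+x\<in>{0..<1}. ennreal \<bar>psi11 (pgf p) x\<bar> \<partial>lborel) < \<infinity> \<longleftrightarrow>
           (\<lambda>k. p k * real k ^ 3 * ln (real k)) summable_on {2..}) \<and>
         (\<not> (\<lambda>k. p k * real k ^ 3 * ln (real k)) summable_on {2..} \<longrightarrow>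
           slowly_varying_at_zero (L11 (pgf p)) \<and>
           (L11 (pgf p) \<longlongrightarrow> 0) (at_right 0))"
proof -
  interpret critical_law p
  proof
    \<comment> \<open>The value 1 is finite, so the infinite branch is excluded; for r = 1 the
      binomial coefficient is k itself.\<close>
    show "(\<Sum>k. p k * real k) = 1"
      using deriv_at_one_pgf[OF assms(1,2), of 1] assms(4) by (simp split: if_splits)
    show "summable (\<lambda>k. p k * real (k choose 3))"
      using deriv_at_one_pgf[OF assms(1,2), of 3] assms(5) by (simp split: if_splits)
  qed (use assms in \<open>auto simp: pgf_def\<close>)
  show ?thesis
    using nn_integral_psi11_finite_iff nn_integral_F_3_finite_iff summable_ln_iff
      slowly_varying_L11 L11_tendsto_0 by auto
qed

end
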